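(* For every finite tadpole-free undirected graph $\widehat G$ (multiple edges allowed) with nonempty vertex set, $$\sum_{G\in\operatorname{Ori}(\widehat G)}e(G)=1 .$$
   Context: $\operatorname{Ori}(\widehat G)$ is the set of the $2^{|E|}$ directed multigraphs obtained by choosing independently one of the two orientations of every edge of $\widehat G=(V,E)$; parallel edges are regarded as distinct. A tadpole is a self-loop. For a tadpole-free directed multigraph $G$ with vertex set $V$: $e(G)=|\operatorname{LE}(G)|/|V|!$ if $G$ has no directed cycle, where $\operatorname{LE}(G)$ is the set of linear extensions of the partial order on $V$ induced by the directed edges; $e(G)=0$ if $G$ contains a directed cycle. *)

theory Defs
  imports Complex_Main "HOL-Library.FuncSet" "Graph_Theory.Arc_Walk"
begin

section \<open>Undirected multigraphs\<close>

record ('v, 'e) multigraph =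
  mverts :: "'v set"
  medges :: "'e set"
  mends :: "'e \<Rightarrow> 'v set"

text \<open>Edges carry their own identity, so distinct edges may have the same ends.
  An edge whose set of ends is a singleton is a self-loop.\<close>

locale fin_multigraph =
  fixes G :: "('v, 'e) multigraph"
  assumes finite_mverts: "finite (mverts G)"
    and finite_medges: "finite (medges G)"
    and mends_subset: "e \<in> medges G \<Longrightarrow> mends G e \<subseteq> mverts G"
    and card_mends: "e \<in> medges G \<Longrightarrow> card (mends G e) \<in> {1, 2}"

definition tadpole :: "('v, 'e) multigraph \<Rightarrow> 'e \<Rightarrow> bool" where
  "tadpole G e \<longleftrightarrow> e \<in> medges G \<and> card (mends G e) = 1"

definition tadpole_free :: "('v, 'e) multigraph \<Rightarrow> bool" where
  "tadpole_free G \<longleftrightarrow> (\<nexists>e. tadpole G e)"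


section \<open>Orientations\<close>

text \<open>Tail and head are required to be extensional so that each choice of directions of the
  edges is represented by exactly one digraph; see \<open>card_orientations\<close>.  Self-loops would get
  only one orientation each, so the definition is meant for tadpole-free multigraphs.\<close>

definition orientations :: "('v, 'e) multigraph \<Rightarrow> ('v, 'e) pre_digraph set" where
  "orientations G =
    {D. verts D = mverts G \<and> arcs D = medges G \<and>
        tail D \<in> extensional (medges G) \<and> head D \<in> extensional (medges G) \<and>
        (\<forall>e \<in> medges G. {tail D e, head D e} = mends G e)}"

lemma card_orientations:
  assumes "fin_multigraph G" and "tadpole_free G"
  shows "card (orientations G) = 2 ^ card (medges G)"
proof -
  interpret fin_multigraph G by fact
  let ?E = "medges G"
  have two: "card (mends G e) = 2" if "e \<in> ?E" for e
    using card_mends[OF that] assms(2) that by (auto simp: tadpole_free_def tadpole_def)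
  have "bij_betw tail (orientations G) (PiE ?E (mends G))"
    unfolding bij_betw_def
  proof (intro conjI inj_onI equalityI subsetI)
    fix C D assume CD: "C \<in> orientations G" "D \<in> orientations G" and t: "tail C = tail D"
    have "head C e = head D e" for e
    proof (cases "e \<in> ?E")
      case True
      then have "{tail D e, head C e} = {tail D e, head D e}"
        using CD t by (auto simp: orientations_def)
      then show ?thesis by (metis doubleton_eq_iff)
    next
      case False
      with CD show ?thesis by (auto simp: orientations_def extensional_def)
    qed
    with CD t show "C = D"
      by (intro pre_digraph.equality) (auto simp: orientations_def)
  next
    fix t assume "t \<in> tail ` orientations G"
    then show "t \<in> PiE ?E (mends G)" by (auto simp: orientations_def PiE_def)
  next
    fix t assume t: "t \<in> PiE ?E (mends G)"
    have "\<exists>y. {t e, y} = mends G e" if "e \<in> ?E" for e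
    proof -
      have "t e \<in> mends G e" using t that by auto
      with two[OF that] show ?thesis by (auto simp: card_2_iff)
    qed
    then obtain h where h: "\<And>e. e \<in> ?E \<Longrightarrow> {t e, h e} = mends G e" by metis
    let ?D = "\<lparr>verts = mverts G, arcs = ?E, tail = t, head = restrict h ?E\<rparr>"
    have "?D \<in> orientations G" using t h by (auto simp: orientations_def PiE_def)
    then show "t \<in> tail ` orientations G" by (intro image_eqI[of _ _ ?D]) auto
  qed
  then have "card (orientations G) = card (PiE ?E (mends G))" by (rule bij_betw_same_card)
  also have "\<dots> = 2 ^ card ?E"
    using two by (simp add: card_PiE finite_medges)
  finally show ?thesis .
qed


section \<open>Linear extensions\<close>

definition induced_order :: "('v, 'e) pre_digraph \<Rightarrow> 'v rel" where
  "induced_order D = {(u, v). u \<rightarrow>\<^sup>*\<^bsub>D\<^esub> v}"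

definition linear_extensions :: "('v, 'e) pre_digraph \<Rightarrow> 'v rel set" where
  "linear_extensions D = {r. linear_order_on (verts D) r \<and> induced_order D \<subseteq> r}"

definition linear_extension_ratio :: "('v, 'e) pre_digraph \<Rightarrow> real" where
  "linear_extension_ratio D =
    (if \<exists>p. pre_digraph.cycle D p then 0
     else real (card (linear_extensions D)) / fact (card (verts D)))"

end

theory Submission
  imports Defs
begin

text \<open>
  Multiplied by \<open>|V|!\<close>, the claim is a double count of the pairs of an orientation and a linear
  order on \<open>V\<close> extending it.  A linear order on \<open>V\<close> extends exactly one orientation, the one that
  directs every edge from its smaller to its larger end
  (\<open>card_orientations_extended_by_linear_order\<close>), so the number of pairs is the number \<open>|V|!\<close> of
  linear orders on \<open>V\<close> (\<open>card_linear_orders_on\<close>).  Orientations with a directed cycle need no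
  separate treatment: they have no linear extension at all (\<open>linear_extensions_of_cyclic\<close>), so the
  value 0 assigned to them is again the number of linear extensions divided by \<open>|V|!\<close>.
\<close>

section \<open>Counting linear orders\<close>

text \<open>A linear order is determined by its least element and its restriction to the other
  elements, both of which are arbitrary.\<close>

lemma bij_betw_linear_orders_least:
  assumes "m \<in> A"
  shows "bij_betw (\<lambda>r. Restr r (A - {m}))
    {r. linear_order_on A r \<and> (\<forall>a\<in>A. (m, a) \<in> r)} {s. linear_order_on (A - {m}) s}"
proof (rule bij_betw_byWitness[where f' = "\<lambda>s. s \<union> {m} \<times> A"])
  show "\<forall>r\<in>{r. linear_order_on A r \<and> (\<forall>a\<in>A. (m, a) \<in> r)}.
      Restr r (A - {m}) \<union> {m} \<times> A = r"
  proof (clarify, intro equalityI subsetI)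
    fix r x assume r: "linear_order_on A r" "\<forall>a\<in>A. (m, a) \<in> r" and x: "x \<in> r"
    obtain a b where [simp]: "x = (a, b)" by (cases x)
    have "a \<in> A" "b \<in> A" using r x by (auto simp: order_on_defs)
    moreover have "a = m" if "b = m"
      using r x that \<open>a \<in> A\<close> antisymD[of r a m] by (simp add: order_on_defs)
    ultimately show "x \<in> Restr r (A - {m}) \<union> {m} \<times> A" using x by auto
  qed auto
  show "\<forall>s\<in>{s. linear_order_on (A - {m}) s}. Restr (s \<union> {m} \<times> A) (A - {m}) = s"
    by (auto simp: order_on_defs)
  show "(\<lambda>r. Restr r (A - {m})) ` {r. linear_order_on A r \<and> (\<forall>a\<in>A. (m, a) \<in> r)}
      \<subseteq> {s. linear_order_on (A - {m}) s}"
  proof clarify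
    fix r assume r: "linear_order_on A r"
    then have "trans (Restr r (A - {m}))" "antisym (Restr r (A - {m}))"
      by (simp_all add: order_on_defs trans_Restr antisym_Restr)
    then show "linear_order_on (A - {m}) (Restr r (A - {m}))"
      using r by (simp add: order_on_defs refl_on_def total_on_def)
  qed
  show "(\<lambda>s. s \<union> {m} \<times> A) ` {s. linear_order_on (A - {m}) s}
      \<subseteq> {r. linear_order_on A r \<and> (\<forall>a\<in>A. (m, a) \<in> r)}"
  proof (clarify, intro conjI ballI)
    fix s assume s: "linear_order_on (A - {m}) s"
    then have sub: "s \<subseteq> (A - {m}) \<times> (A - {m})" and "trans s" "antisym s"
      and rest: "refl_on (A - {m}) s" "total_on (A - {m}) s"
      by (auto simp: order_on_defs)
    have "trans (s \<union> {m} \<times> A)"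
    proof (rule transI)
      fix a b c assume "(a, b) \<in> s \<union> {m} \<times> A" "(b, c) \<in> s \<union> {m} \<times> A"
      with sub show "(a, c) \<in> s \<union> {m} \<times> A"
        using transD[OF \<open>trans s\<close>, of a b c] assms by auto
    qed
    moreover have "antisym (s \<union> {m} \<times> A)"
    proof (rule antisymI)
      fix a b assume "(a, b) \<in> s \<union> {m} \<times> A" "(b, a) \<in> s \<union> {m} \<times> A"
      with sub show "a = b" using antisymD[OF \<open>antisym s\<close>, of a b] by auto
    qed
    moreover have "s \<union> {m} \<times> A \<subseteq> A \<times> A" using sub assms by auto
    moreover have "refl_on A (s \<union> {m} \<times> A)" "total_on A (s \<union> {m} \<times> A)"
      using rest unfolding refl_on_def total_on_def by auto
    ultimately show "linear_order_on A (s \<union> {m} \<times> A)"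
      by (auto simp: order_on_defs)
  qed auto
qed

lemma ex_least_linear_order_on:
  assumes "finite A" "A \<noteq> {}" "linear_order_on A r"
  shows "\<exists>m\<in>A. \<forall>a\<in>A. (m, a) \<in> r"
proof -
  have "r \<subseteq> A \<times> A" using assms by (auto simp: order_on_defs)
  then have "finite r" using assms(1) by (meson finite_SigmaI finite_subset)
  with assms(3) have "well_order_on A r" using linear_order_on_well_order_on by blast
  then have "wf (r - Id)" by (simp add: well_order_on_def)
  moreover obtain x where "x \<in> A" using assms(2) by auto
  ultimately obtain m where m: "m \<in> A" "\<And>y. (y, m) \<in> r - Id \<Longrightarrow> y \<notin> A"
    by (metis wfE_min)
  have "(m, a) \<in> r" if "a \<in> A" for a
  proof (cases "a = m")
    case True
    with that assms(3) show ?thesis by (simp add: order_on_defs refl_on_def)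
  next
    case False
    then have "(a, m) \<notin> r" using m(2) that by blast
    with False that m(1) assms(3) show ?thesis by (auto simp: order_on_defs total_on_def)
  qed
  with m(1) show ?thesis by auto
qed

lemma finite_linear_orders_on:
  assumes "finite A"
  shows "finite {r. linear_order_on A r}"
  by (rule finite_subset[of _ "Pow (A \<times> A)"]) (use assms in \<open>auto simp: order_on_defs\<close>)

lemma card_linear_orders_on:
  assumes "finite A"
  shows "card {r. linear_order_on A r} = fact (card A)"
  using assms
proof (induction "card A" arbitrary: A)
  case 0
  then have "{r. linear_order_on A r} = {{}}"
    by (auto simp: order_on_defs refl_on_def)
  with 0 show ?case by simp
next
  case (Suc n)
  let ?L = "\<lambda>m. {r. linear_order_on A r \<and> (\<forall>a\<in>A. (m, a) \<in> r)}"
  have "A \<noteq> {}" using Suc.hyps(2) by auto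
  then have "{r. linear_order_on A r} = (\<Union>m\<in>A. ?L m)"
    using ex_least_linear_order_on[OF \<open>finite A\<close>] by auto
  also have "card \<dots> = (\<Sum>m\<in>A. card (?L m))"
  proof (rule card_UN_disjoint)
    show "\<forall>m\<in>A. finite (?L m)"
      using finite_linear_orders_on[OF \<open>finite A\<close>] by simp
    show "\<forall>m\<in>A. \<forall>m'\<in>A. m \<noteq> m' \<longrightarrow> ?L m \<inter> ?L m' = {}"
    proof (intro ballI impI equals0I)
      fix m m' r assume "m \<in> A" "m' \<in> A" "m \<noteq> m'" "r \<in> ?L m \<inter> ?L m'"
      then show False using antisymD[of r m m'] by (simp add: order_on_defs)
    qed
  qed fact
  also have "\<dots> = (\<Sum>m\<in>A. fact n)"
  proof (rule sum.cong)
    fix m assume m: "m \<in> A"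
    then have "card (A - {m}) = n" using Suc.hyps(2) by simp
    then show "card (?L m) = fact n"
      using bij_betw_same_card[OF bij_betw_linear_orders_least[OF m]] Suc.hyps(1)[of "A - {m}"]
        \<open>finite A\<close> by simp
  qed simp
  also have "\<dots> = fact (card A)" using Suc.hyps(2)[symmetric] by simp
  finally show ?case .
qed


section \<open>Orientations and linear orders\<close>

lemma wf_digraph_orientation:
  assumes "fin_multigraph G" "D \<in> orientations G"
  shows "wf_digraph D"
proof
  interpret fin_multigraph G by fact
  fix e assume "e \<in> arcs D"
  then have "{tail D e, head D e} \<subseteq> verts D"
    using assms(2) mends_subset[of e] by (auto simp: orientations_def)
  then show "tail D e \<in> verts D" "head D e \<in> verts D" by auto
qed

lemma linear_extensions_eq:
  assumes "wf_digraph D"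
  shows "linear_extensions D = {r. linear_order_on (verts D) r \<and> arcs_ends D \<subseteq> r}"
proof -
  have "induced_order D \<subseteq> r \<longleftrightarrow> arcs_ends D \<subseteq> r" if r: "linear_order_on (verts D) r" for r
  proof
    assume "induced_order D \<subseteq> r"
    then show "arcs_ends D \<subseteq> r"
      using wf_digraph.adj_in_verts[OF assms] wf_digraph.reachable_adjI[OF assms]
      by (auto simp: induced_order_def)
  next
    assume ends: "arcs_ends D \<subseteq> r"
    have "(u, v) \<in> r" if "(u, v) \<in> rtrancl_on (verts D) (arcs_ends D)" for u v
      using that
    proof induction
      case base
      then show ?case using r by (auto simp: order_on_defs refl_on_def)
    next
      case (step y z)
      then show ?case using r ends by (auto simp: order_on_defs trans_def)
    qed
    then show "induced_order D \<subseteq> r" by (auto simp: induced_order_def reachable_def)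
  qed
  then show ?thesis by (auto simp: linear_extensions_def)
qed

lemma linear_extensions_of_cyclic:
  assumes "wf_digraph D" "\<And>e. e \<in> arcs D \<Longrightarrow> tail D e \<noteq> head D e" "pre_digraph.cycle D p"
  shows "linear_extensions D = {}"
proof (rule ccontr)
  interpret wf_digraph D by fact
  assume "linear_extensions D \<noteq> {}"
  then obtain r where r: "linear_order_on (verts D) r" "arcs_ends D \<subseteq> r"
    using linear_extensions_eq[OF assms(1)] by auto
  obtain u where "awalk u p u" "p \<noteq> []" using assms(3) by (auto simp: cycle_def)
  then have "(u, u) \<in> (arcs_ends D)\<^sup>+" by (auto simp: reachable1_awalk)
  moreover have "arcs_ends D \<subseteq> r - Id" using r(2) assms(2) by (auto simp: arcs_ends_conv)
  ultimately have "(u, u) \<in> (r - Id)\<^sup>+" by (meson trancl_mono subsetD)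
  with linear_order_on_acyclic[OF r(1)] show False by (auto simp: acyclic_def)
qed

lemma orientation_no_loops:
  assumes "tadpole_free G" "D \<in> orientations G" "e \<in> arcs D"
  shows "tail D e \<noteq> head D e"
proof
  assume "tail D e = head D e"
  then have "mends G e = {head D e}" using assms by (force simp: orientations_def)
  with assms show False by (auto simp: tadpole_free_def tadpole_def orientations_def)
qed

lemma linear_extension_ratio_orientation:
  assumes "fin_multigraph G" "tadpole_free G" "D \<in> orientations G"
  shows "linear_extension_ratio D = real (card (linear_extensions D)) / fact (card (mverts G))"
proof -
  have "verts D = mverts G" using assms by (auto simp: orientations_def)
  moreover have "linear_extensions D = {}" if "pre_digraph.cycle D p" for p
    using linear_extensions_of_cyclic wf_digraph_orientation orientation_no_loops assms that
    by metis
  ultimately show ?thesis by (auto simp: linear_extension_ratio_def)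
qed

lemma card_orientations_extended_by_linear_order:
  assumes "fin_multigraph G" "tadpole_free G" "linear_order_on (mverts G) r"
  shows "card {D \<in> orientations G. arcs_ends D \<subseteq> r} = 1"
proof -
  interpret fin_multigraph G by fact
  have "\<exists>a b. mends G e = {a, b} \<and> (a, b) \<in> r" if e: "e \<in> medges G" for e
  proof -
    have "card (mends G e) = 2"
      using card_mends[OF e] assms(2) e by (auto simp: tadpole_free_def tadpole_def)
    then obtain a b where ab: "mends G e = {a, b}" "a \<noteq> b" by (auto simp: card_2_iff)
    moreover have "a \<in> mverts G" "b \<in> mverts G" using mends_subset[OF e] ab by auto
    ultimately have "(a, b) \<in> r \<or> (b, a) \<in> r"
      using assms(3) by (auto simp: order_on_defs total_on_def)
    with ab show ?thesis by (metis insert_commute)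
  qed
  then obtain t h where th: "\<And>e. e \<in> medges G \<Longrightarrow> mends G e = {t e, h e} \<and> (t e, h e) \<in> r"
    by metis
  define D where "D = \<lparr>verts = mverts G, arcs = medges G,
    tail = restrict t (medges G), head = restrict h (medges G)\<rparr>"
  have "D \<in> orientations G" "arcs_ends D \<subseteq> r"
    using th by (auto simp: D_def orientations_def arcs_ends_conv)
  moreover have "C = D" if C: "C \<in> orientations G" "arcs_ends C \<subseteq> r" for C
  proof -
    have "tail C e = tail D e \<and> head C e = head D e" for e
    proof (cases "e \<in> medges G")
      case True
      then have "{tail C e, head C e} = {t e, h e}" "(tail C e, head C e) \<in> r"
        using C th by (auto simp: orientations_def arcs_ends_conv)
      then have "tail C e = t e \<and> head C e = h e"
        using th[OF True] assms(3) antisymD[of r "t e" "h e"]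
        by (auto simp: doubleton_eq_iff order_on_defs)
      with True show ?thesis by (simp add: D_def)
    next
      case False
      with C show ?thesis by (auto simp: D_def orientations_def extensional_def)
    qed
    then have "tail C = tail D" "head C = head D" by auto
    with C show ?thesis
      by (intro pre_digraph.equality) (simp_all add: D_def orientations_def)
  qed
  ultimately have "{D \<in> orientations G. arcs_ends D \<subseteq> r} = {D}" by blast
  then show ?thesis by simp
qed

theorem proposition12p1:
  fixes G :: "('v, 'e) multigraph"
  assumes "fin_multigraph G"
    and "tadpole_free G"
    and "mverts G \<noteq> {}"
  shows "(\<Sum>D\<in>orientations G. linear_extension_ratio D) = 1"
proof -
  let ?L = "{r. linear_order_on (mverts G) r}"
  have finV: "finite (mverts G)" using assms(1) by (rule fin_multigraph.finite_mverts)
  have finO: "finite (orientations G)"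
    using card_orientations[OF assms(1,2)] by (intro card_ge_0_finite) simp
  have "(\<Sum>D\<in>orientations G. card (linear_extensions D))
      = (\<Sum>D\<in>orientations G. card {r \<in> ?L. arcs_ends D \<subseteq> r})"
    using linear_extensions_eq[OF wf_digraph_orientation[OF assms(1)]]
    by (intro sum.cong) (auto simp: orientations_def)
  also have "\<dots> = 1 * card ?L"
    using card_orientations_extended_by_linear_order[OF assms(1,2)]
    by (intro sum_multicount finO finite_linear_orders_on finV) auto
  also have "\<dots> = fact (card (mverts G))"
    using card_linear_orders_on[OF finV] by simp
  finally have "(\<Sum>D\<in>orientations G. real (card (linear_extensions D)))
      = fact (card (mverts G))"
    by (metis of_nat_fact of_nat_sum)
  then show ?thesis
    using linear_extension_ratio_orientation[OF assms(1,2)]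
    by (simp flip: sum_divide_distrib)
qed

end
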